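(* Let $\{\mathsf{C}_j\mid j\in J\}$ be a set of closure operations and let $\mathsf{C}=\langle \mathsf{C}_j\mid j\in J\rangle$ be their join. Then (1) the class map $\mathsf{C}$ is a closure operation; (2) if $\mathfrak{X}$ is a class of algebras, then $\mathsf{C}\mathfrak{X}$ is the uniquely determined smallest class containing $\mathfrak{X}$ which is simultaneously $\mathsf{C}_j$-closed for all $j\in J$; (3) in the partial order $\le$ on the set of closure operations, the join $\mathsf{C}$ is the least upper bound of the set $\{\mathsf{C}_j\mid j\in J\}$.
   Context: Algebras are (not necessarily associative) algebras over a field $K$. A class of algebras is a collection of algebras closed under isomorphism; classes are ordered by inclusion. A class map sends classes of algebras to classes of algebras. A closure operation is a class map $\mathsf{C}$ such that (C1) $\mathsf{C}\emptyset=\emptyset$; (C2) $\mathfrak{X}\subseteq\mathsf{C}\mathfrak{X}$ for every class $\mathfrak{X}$ (expanding), and $\mathsf{C}\mathfrak{X}\subseteq\mathsf{C}\mathfrak{Y}$ whenever $\mathfrak{X}\subseteq\mathfrak{Y}$ (monotonic); (C3) $\mathsf{C}(\mathsf{C}\mathfrak{X})=\mathsf{C}\mathfrak{X}$ for every class $\mathfrak{X}$ (idempotent). A class $\mathfrak{X}$ is $\mathsf{C}$-closed if $\mathfrak{X}=\mathsf{C}\mathfrak{X}$. For class maps, $\mathsf{C}_1\le\mathsf{C}_2$ means $\mathsf{C}_1\mathfrak{X}\subseteq\mathsf{C}_2\mathfrak{X}$ for every class of algebras $\mathfrak{X}$. The join $\mathsf{C}=\langle\mathsf{C}_j\mid j\in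 J\rangle$ of a set of closure operations is defined, for any class $\mathfrak{X}$, by $$\mathsf{C}\mathfrak{X}:=\bigcap\{\mathfrak{Y}\mid \mathfrak{X}\subseteq\mathfrak{Y}=\mathsf{C}_j\mathfrak{Y}\text{ for all }j\in J\}.$$ *)

theory Defs
  imports "HOL-Algebra.Module" "HOL-Library.FuncSet"
begin

text \<open>
  A not necessarily associative algebra over a field is a vector space with a bilinear
  multiplication; no unit is required. The record type \<^typ>\<open>('k, 'a) module\<close> also has a field for
  a multiplicative unit, which is not constrained here and is ignored by isomorphisms.
\<close>

locale nonassoc_algebra = module K A + field K for K (structure) and A (structure) +
  assumes mult_closed:
      "\<lbrakk>x \<in> carrier A; y \<in> carrier A\<rbrakk> \<Longrightarrow> x \<otimes>\<^bsub>A\<^esub> y \<in> carrier A"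
    and mult_l_distr:
      "\<lbrakk>x \<in> carrier A; y \<in> carrier A; z \<in> carrier A\<rbrakk> \<Longrightarrow>
        (x \<oplus>\<^bsub>A\<^esub> y) \<otimes>\<^bsub>A\<^esub> z = (x \<otimes>\<^bsub>A\<^esub> z) \<oplus>\<^bsub>A\<^esub> (y \<otimes>\<^bsub>A\<^esub> z)"
    and mult_r_distr:
      "\<lbrakk>x \<in> carrier A; y \<in> carrier A; z \<in> carrier A\<rbrakk> \<Longrightarrow>
        z \<otimes>\<^bsub>A\<^esub> (x \<oplus>\<^bsub>A\<^esub> y) = (z \<otimes>\<^bsub>A\<^esub> x) \<oplus>\<^bsub>A\<^esub> (z \<otimes>\<^bsub>A\<^esub> y)"
    and mult_smult_l:
      "\<lbrakk>a \<in> carrier K; x \<in> carrier A; y \<in> carrier A\<rbrakk> \<Longrightarrow>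
        (a \<odot>\<^bsub>A\<^esub> x) \<otimes>\<^bsub>A\<^esub> y = a \<odot>\<^bsub>A\<^esub> (x \<otimes>\<^bsub>A\<^esub> y)"
    and mult_smult_r:
      "\<lbrakk>a \<in> carrier K; x \<in> carrier A; y \<in> carrier A\<rbrakk> \<Longrightarrow>
        x \<otimes>\<^bsub>A\<^esub> (a \<odot>\<^bsub>A\<^esub> y) = a \<odot>\<^bsub>A\<^esub> (x \<otimes>\<^bsub>A\<^esub> y)"

definition algebra_iso ::
  "('k, 'r) ring_scheme \<Rightarrow> ('k, 'a) module \<Rightarrow> ('k, 'a) module \<Rightarrow> ('a \<Rightarrow> 'a) set"
  where "algebra_iso K A B =
    {h. bij_betw h (carrier A) (carrier B) \<and>
        (\<forall>x\<in>carrier A. \<forall>y\<in>carrier A. h (x \<oplus>\<^bsub>A\<^esub> y) = h x \<oplus>\<^bsub>B\<^esub> h y) \<and>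
        (\<forall>x\<in>carrier A. \<forall>y\<in>carrier A. h (x \<otimes>\<^bsub>A\<^esub> y) = h x \<otimes>\<^bsub>B\<^esub> h y) \<and>
        (\<forall>a\<in>carrier K. \<forall>x\<in>carrier A. h (a \<odot>\<^bsub>A\<^esub> x) = a \<odot>\<^bsub>B\<^esub> h x)}"

text \<open>
  The type \<^typ>\<open>'a\<close> plays the role of the universe: all algebras have a subset of it as carrier,
  and a class of algebras is an isomorphism-closed set of such algebras. The results are
  stated for arbitrary \<^typ>\<open>'a\<close>.
\<close>

definition algebra_classes :: "('k, 'r) ring_scheme \<Rightarrow> ('k, 'a) module set set"
  where "algebra_classes K =
    {X. (\<forall>A\<in>X. nonassoc_algebra K A) \<and>
        (\<forall>A\<in>X. \<forall>B. nonassoc_algebra K B \<and> algebra_iso K A B \<noteq> {} \<longrightarrow> B \<in> X)}"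

text \<open>
  Class maps are taken extensional (\<^term>\<open>undefined\<close> on sets that are not classes), so that two
  class maps are equal iff they agree on all classes.
\<close>

definition class_maps ::
  "('k, 'r) ring_scheme \<Rightarrow> (('k, 'a) module set \<Rightarrow> ('k, 'a) module set) set"
  where "class_maps K = algebra_classes K \<rightarrow>\<^sub>E algebra_classes K"

definition closure_operation ::
  "('k, 'r) ring_scheme \<Rightarrow> (('k, 'a) module set \<Rightarrow> ('k, 'a) module set) \<Rightarrow> bool"
  where "closure_operation K C \<longleftrightarrow>
    C \<in> class_maps K \<and>
    C {} = {} \<and>
    (\<forall>X\<in>algebra_classes K. X \<subseteq> C X) \<and>
    (\<forall>X\<in>algebra_classes K. \<forall>Y\<in>algebra_classes K. X \<subseteq> Y \<longrightarrow> C X \<subseteq> C Y) \<and>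
    (\<forall>X\<in>algebra_classes K. C (C X) = C X)"

definition class_closed ::
  "(('k, 'a) module set \<Rightarrow> ('k, 'a) module set) \<Rightarrow> ('k, 'a) module set \<Rightarrow> bool"
  where "class_closed C X \<longleftrightarrow> X = C X"

definition class_map_le ::
  "('k, 'r) ring_scheme \<Rightarrow> (('k, 'a) module set \<Rightarrow> ('k, 'a) module set) \<Rightarrow>
    (('k, 'a) module set \<Rightarrow> ('k, 'a) module set) \<Rightarrow> bool"
  where "class_map_le K C D \<longleftrightarrow> (\<forall>X\<in>algebra_classes K. C X \<subseteq> D X)"

definition closure_join ::
  "('k, 'r) ring_scheme \<Rightarrow> 'j set \<Rightarrow> ('j \<Rightarrow> ('k, 'a) module set \<Rightarrow> ('k, 'a) module set) \<Rightarrow>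
    ('k, 'a) module set \<Rightarrow> ('k, 'a) module set"
  where "closure_join K J C =
    (\<lambda>X\<in>algebra_classes K.
      \<Inter>{Y \<in> algebra_classes K. X \<subseteq> Y \<and> (\<forall>j\<in>J. class_closed (C j) Y)})"

definition class_order :: "('k, 'r) ring_scheme \<Rightarrow> ('k, 'a) module set gorder"
  where "class_order K = \<lparr>carrier = algebra_classes K, eq = (=), le = (\<subseteq>)\<rparr>"

definition closure_order ::
  "('k, 'r) ring_scheme \<Rightarrow> (('k, 'a) module set \<Rightarrow> ('k, 'a) module set) gorder"
  where "closure_order K =
    \<lparr>carrier = {C. closure_operation K C}, eq = (=), le = class_map_le K\<rparr>"

lemma partial_order_class_order: "partial_order (class_order K)"
  by unfold_locales (auto simp: class_order_def)

lemma partial_order_closure_order: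
  fixes K :: "('k, 'r) ring_scheme"
  shows "partial_order
    (closure_order K :: (('k, 'a) module set \<Rightarrow> ('k, 'a) module set) gorder)"
proof -
  have "C = D"
    if "C \<in> class_maps K" "D \<in> class_maps K" "class_map_le K C D" "class_map_le K D C"
    for C D :: "('k, 'a) module set \<Rightarrow> ('k, 'a) module set"
  proof (rule PiE_ext)
    show "C \<in> algebra_classes K \<rightarrow>\<^sub>E algebra_classes K" "D \<in> algebra_classes K \<rightarrow>\<^sub>E algebra_classes K"
      using that by (simp_all add: class_maps_def)
    show "C X = D X" if "X \<in> algebra_classes K" for X
      using that \<open>class_map_le K C D\<close> \<open>class_map_le K D C\<close>
      by (simp add: class_map_le_def subset_antisym)
  qed
  moreover have "class_map_le K C E"
    if "class_map_le K C D" "class_map_le K D E"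
    for C D E :: "('k, 'a) module set \<Rightarrow> ('k, 'a) module set"
    using that unfolding class_map_le_def by (meson order_trans)
  moreover have "class_map_le K C C" for C :: "('k, 'a) module set \<Rightarrow> ('k, 'a) module set"
    by (simp add: class_map_le_def)
  ultimately show ?thesis
    by unfold_locales (auto simp: closure_order_def closure_operation_def)
qed

end

theory Submission
  imports Defs
begin

text \<open>
  A closure operation is determined by its closed classes, and a system of classes that is stable
  under nonempty intersections has a least member above each class that lies below some member.
  Monotonicity makes the classes closed under all \<open>C j\<close> stable under intersection
  (\<open>closed_superclasses_Inter\<close>), and there always is one above \<open>X\<close>, namely the class of all
  algebras (\<open>all_algebras_closed_superclass\<close>). Hence the intersection that defines the value of
  the join at \<open>X\<close> is itself a simultaneously closed class above \<open>X\<close>, and so the least one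
  (\<open>closure_join_in_closed_superclasses\<close>, \<open>closure_join_least\<close>).

  The rest is read off from this. The join is monotonic, because a simultaneously closed class
  above \<open>Y\<close> is also one above every \<open>X \<subseteq> Y\<close>; it is idempotent, because its values are themselves
  simultaneously closed; and it preserves \<open>{}\<close>, because \<open>{}\<close> is closed under every \<open>C j\<close>. It
  dominates each \<open>C j\<close>, because a \<open>C j\<close>-closed class above \<open>X\<close> contains \<open>C j X\<close>. Finally, if a
  closure operation \<open>D\<close> dominates every \<open>C j\<close>, then \<open>C j (D X) \<subseteq> D (D X) = D X\<close>, so \<open>D X\<close> is a
  simultaneously closed class above \<open>X\<close> and therefore contains the value of the join at \<open>X\<close>.
\<close>

abbreviation closed_superclasses ::
  "('k, 'r) ring_scheme \<Rightarrow> 'j set \<Rightarrow> ('j \<Rightarrow> ('k, 'a) module set \<Rightarrow> ('k, 'a) module set) \<Rightarrow>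
    ('k, 'a) module set \<Rightarrow> ('k, 'a) module set set"
  where "closed_superclasses K J C X \<equiv>
    {Y \<in> algebra_classes K. X \<subseteq> Y \<and> (\<forall>j\<in>J. class_closed (C j) Y)}"

lemma closure_operation_in_classes:
  "closure_operation K C \<Longrightarrow> X \<in> algebra_classes K \<Longrightarrow> C X \<in> algebra_classes K"
  by (auto simp: closure_operation_def class_maps_def)

lemma closure_operation_empty: "closure_operation K C \<Longrightarrow> C {} = {}"
  by (simp add: closure_operation_def)

lemma closure_operation_expanding:
  "closure_operation K C \<Longrightarrow> X \<in> algebra_classes K \<Longrightarrow> X \<subseteq> C X"
  by (simp add: closure_operation_def)

lemma closure_operation_mono:
  "closure_operation K C \<Longrightarrow> X \<in> algebra_classes K \<Longrightarrow> Y \<in> algebra_classes K \<Longrightarrow> X \<subseteq> Y \<Longrightarrow>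
    C X \<subseteq> C Y"
  by (simp add: closure_operation_def)

lemma closure_operation_idem:
  "closure_operation K C \<Longrightarrow> X \<in> algebra_classes K \<Longrightarrow> C (C X) = C X"
  by (simp add: closure_operation_def)

lemma class_closedI:
  assumes "closure_operation K C" "X \<in> algebra_classes K" "C X \<subseteq> X"
  shows "class_closed C X"
  using closure_operation_expanding[OF assms(1,2)] assms(3) by (auto simp: class_closed_def)

lemma empty_algebra_class: "{} \<in> algebra_classes K"
  by (simp add: algebra_classes_def)

lemma all_algebras_class: "{A. nonassoc_algebra K A} \<in> algebra_classes K"
  by (auto simp: algebra_classes_def)

lemma algebra_class_subset_all: "X \<in> algebra_classes K \<Longrightarrow> X \<subseteq> {A. nonassoc_algebra K A}"
  by (auto simp: algebra_classes_def)

text \<open>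
  Nonemptiness matters: the empty intersection is the whole type, which also contains records
  that are not algebras.
\<close>

lemma algebra_classes_Inter:
  assumes "F \<subseteq> algebra_classes K" and "F \<noteq> {}"
  shows "\<Inter>F \<in> algebra_classes K"
  using assms unfolding algebra_classes_def by blast

text \<open>
  This largest class ensures that the intersection defining the join has a nonempty index set.
\<close>

lemma all_algebras_closed_superclass:
  assumes "\<And>j. j \<in> J \<Longrightarrow> closure_operation K (C j)" and "X \<in> algebra_classes K"
  shows "{A. nonassoc_algebra K A} \<in> closed_superclasses K J C X"
  using assms
  by (auto intro!: class_closedI all_algebras_class
      dest: algebra_class_subset_all
        closure_operation_in_classes[THEN algebra_class_subset_all, OF _ all_algebras_class])

lemma closed_superclasses_Inter:
  assumes C: "\<And>j. j \<in> J \<Longrightarrow> closure_operation K (C j)"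
    and F: "F \<subseteq> closed_superclasses K J C X" "F \<noteq> {}"
  shows "\<Inter>F \<in> closed_superclasses K J C X"
proof -
  have cls: "\<Inter>F \<in> algebra_classes K"
    using F by (intro algebra_classes_Inter) auto
  moreover have "class_closed (C j) (\<Inter>F)" if "j \<in> J" for j
  proof (rule class_closedI[OF C[OF that] cls], rule Inter_greatest)
    fix Y assume "Y \<in> F"
    then have Y: "Y \<in> algebra_classes K" "C j Y = Y"
      using F that by (auto simp: class_closed_def)
    have "C j (\<Inter>F) \<subseteq> C j Y"
      using \<open>Y \<in> F\<close> by (intro closure_operation_mono[OF C[OF that] cls Y(1)]) auto
    with Y(2) show "C j (\<Inter>F) \<subseteq> Y"
      by simp
  qed
  ultimately show ?thesis
    using F by blast
qed

lemma closure_join_in_closed_superclasses: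
  assumes "\<And>j. j \<in> J \<Longrightarrow> closure_operation K (C j)" and "X \<in> algebra_classes K"
  shows "closure_join K J C X \<in> closed_superclasses K J C X"
  unfolding closure_join_def restrict_apply'[OF assms(2)]
  using all_algebras_closed_superclass[where J = J and C = C, OF assms]
  by (intro closed_superclasses_Inter assms(1)) auto

lemma closure_join_least:
  assumes "X \<in> algebra_classes K" and "Y \<in> closed_superclasses K J C X"
  shows "closure_join K J C X \<subseteq> Y"
  using assms by (auto simp: closure_join_def)

lemma closure_operation_closure_join:
  assumes C: "\<And>j. j \<in> J \<Longrightarrow> closure_operation K (C j)"
  shows "closure_operation K (closure_join K J C)"
proof -
  let ?D = "closure_join K J C"
  have D: "?D X \<in> closed_superclasses K J C X" if "X \<in> algebra_classes K" for X
    using closure_join_in_closed_superclasses[OF C that] .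
  have "?D \<in> class_maps K"
    unfolding class_maps_def
  proof (rule PiE_I)
    show "?D X \<in> algebra_classes K" if "X \<in> algebra_classes K" for X
      using D[OF that] by simp
    show "?D X = undefined" if "X \<notin> algebra_classes K" for X
      using that by (simp add: closure_join_def)
  qed
  moreover have "?D {} = {}"
  proof -
    have "{} \<in> closed_superclasses K J C {}"
      using C by (auto simp: empty_algebra_class class_closed_def closure_operation_empty[OF C])
    from closure_join_least[OF empty_algebra_class this] show ?thesis
      by simp
  qed
  moreover have "?D X \<subseteq> ?D Y"
    if "X \<in> algebra_classes K" "Y \<in> algebra_classes K" "X \<subseteq> Y" for X Y
    using D[OF that(2)] that by (intro closure_join_least) auto
  moreover have "?D (?D X) = ?D X" if "X \<in> algebra_classes K" for X
  proof (rule subset_antisym)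
    show "?D (?D X) \<subseteq> ?D X"
      using D[OF that] by (intro closure_join_least) auto
    show "?D X \<subseteq> ?D (?D X)"
      using D[OF that] D[of "?D X"] by simp
  qed
  ultimately show ?thesis
    unfolding closure_operation_def using D by blast
qed

lemma closure_join_upper:
  fixes K :: "('k, 'r) ring_scheme"
    and C :: "'j \<Rightarrow> ('k, 'a) module set \<Rightarrow> ('k, 'a) module set"
  assumes C: "\<And>j. j \<in> J \<Longrightarrow> closure_operation K (C j)" and "j \<in> J"
  shows "class_map_le K (C j) (closure_join K J C)"
  unfolding class_map_le_def
proof
  fix X :: "('k, 'a) module set" assume X: "X \<in> algebra_classes K"
  have D: "closure_join K J C X \<in> closed_superclasses K J C X"
    using closure_join_in_closed_superclasses[OF C X] .
  then have "C j X \<subseteq> C j (closure_join K J C X)"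
    using X by (intro closure_operation_mono[OF C[OF \<open>j \<in> J\<close>]]) auto
  with D \<open>j \<in> J\<close> show "C j X \<subseteq> closure_join K J C X"
    by (auto simp: class_closed_def)
qed

lemma closure_join_minimal:
  fixes K :: "('k, 'r) ring_scheme"
    and C :: "'j \<Rightarrow> ('k, 'a) module set \<Rightarrow> ('k, 'a) module set"
  assumes C: "\<And>j. j \<in> J \<Longrightarrow> closure_operation K (C j)"
    and D: "closure_operation K D"
    and le: "\<And>j. j \<in> J \<Longrightarrow> class_map_le K (C j) D"
  shows "class_map_le K (closure_join K J C) D"
  unfolding class_map_le_def
proof
  fix X :: "('k, 'a) module set" assume X: "X \<in> algebra_classes K"
  note DX = closure_operation_in_classes[OF D X]
  have "class_closed (C j) (D X)" if "j \<in> J" for j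
  proof (rule class_closedI[OF C[OF that] DX])
    have "C j (D X) \<subseteq> D (D X)"
      using le[OF that] DX by (auto simp: class_map_le_def)
    then show "C j (D X) \<subseteq> D X"
      using closure_operation_idem[OF D X] by simp
  qed
  then show "closure_join K J C X \<subseteq> D X"
    using closure_operation_expanding[OF D X] by (intro closure_join_least X) (simp add: DX)
qed

lemma least_class_order_iff:
  "least (class_order K) Z F \<longleftrightarrow> F \<subseteq> algebra_classes K \<and> Z \<in> F \<and> (\<forall>Y\<in>F. Z \<subseteq> Y)"
  by (auto simp: least_def class_order_def)

theorem lemma3p5:
  fixes K :: "('k, 'r) ring_scheme"
    and J :: "'j set"
    and C :: "'j \<Rightarrow> ('k, 'a) module set \<Rightarrow> ('k, 'a) module set"
  assumes "field K"
    and "\<And>j. j \<in> J \<Longrightarrow> closure_operation K (C j)"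
  shows "closure_operation K (closure_join K J C) \<and>
    (\<forall>X\<in>algebra_classes K.
      least (class_order K) (closure_join K J C X)
        {Y \<in> algebra_classes K. X \<subseteq> Y \<and> (\<forall>j\<in>J. class_closed (C j) Y)} \<and>
      (\<forall>Z. least (class_order K) Z
        {Y \<in> algebra_classes K. X \<subseteq> Y \<and> (\<forall>j\<in>J. class_closed (C j) Y)} \<longrightarrow>
          Z = closure_join K J C X)) \<and>
    is_lub (closure_order K) (closure_join K J C) (C ` J)"
proof (intro conjI ballI allI impI)
  note C = assms(2)
  show D: "closure_operation K (closure_join K J C)"
    by (rule closure_operation_closure_join[OF C])
  show least: "least (class_order K) (closure_join K J C X) (closed_superclasses K J C X)"
    if "X \<in> algebra_classes K" for X
    unfolding least_class_order_iff
  proof (intro conjI ballI)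
    show "closed_superclasses K J C X \<subseteq> algebra_classes K"
      by auto
    show "closure_join K J C X \<in> closed_superclasses K J C X"
      using closure_join_in_closed_superclasses[OF C that] .
    show "closure_join K J C X \<subseteq> Y" if "Y \<in> closed_superclasses K J C X" for Y
      using closure_join_least[OF \<open>X \<in> algebra_classes K\<close> that] .
  qed
  show "Z = closure_join K J C X"
    if "X \<in> algebra_classes K" "least (class_order K) Z (closed_superclasses K J C X)" for X Z
    using partial_order.least_unique[OF partial_order_class_order that(2) least[OF that(1)]] .
  show "is_lub (closure_order K) (closure_join K J C) (C ` J)"
    unfolding least_def
  proof (intro conjI ballI)
    show "Upper (closure_order K) (C ` J) \<subseteq> carrier (closure_order K)"
      by (rule Upper_closed)
    show "closure_join K J C \<in> Upper (closure_order K) (C ` J)"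
      using D closure_join_upper[where J = J and C = C, OF C]
      by (auto simp: Upper_def closure_order_def)
    fix E assume "E \<in> Upper (closure_order K) (C ` J)"
    then have "closure_operation K E" "\<And>j. j \<in> J \<Longrightarrow> class_map_le K (C j) E"
      using C by (auto simp: Upper_def closure_order_def)
    then show "le (closure_order K) (closure_join K J C) E"
      using closure_join_minimal[where J = J and C = C, OF C] by (simp add: closure_order_def)
  qed
qed

end
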